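(* Let $G$ be the simply connected 4-dimensional Lie group whose Lie algebra has a basis $X_1,X_2,X_3,X_4$ with $$[X_1,X_4]=[X_2,X_4]=[X_3,X_4]=0,\quad [X_2,X_3]=X_4,\quad [X_3,X_1]=X_2,\quad [X_1,X_2]=-X_3 .$$ For real numbers $a_1,\dots,a_6$ let $$Y_1=X_1+a_4X_2+a_5X_3+a_6X_4,\quad Y_2=X_2+a_2X_3+a_3X_4,\quad Y_3=X_3+a_1X_4,\quad Y_4=X_4 .$$ Suppose the left-invariant metric $g_0$ on $G$ is diagonal in the basis $Y_i$, i.e. $g_0(Y_i,Y_j)=\lambda_i\delta_{ij}$ with $\lambda_i>0$. Let $$\alpha=a_2,\qquad \beta=a_1a_2-a_3-a_4,\qquad \gamma=a_1-a_1a_2^2+a_2a_3+a_2a_4-a_5 .$$ Then the Ricci flow solution $g(t)$ with $g(0)=g_0$ remains diagonal in the basis $Y_i$ if and only if either (i) $\alpha=\beta=\gamma=0$; or (ii) $\beta=\gamma=0$ and $\lambda_2=(1-\alpha^2)\lambda_3$.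
   Context: Elements of the Lie algebra are identified with left-invariant vector fields on $G$. The Ricci flow solution $g(t)$ is the left-invariant solution of $\frac{\partial}{\partial t}g(t)=-2\operatorname{Ric}(g(t))$, $g(0)=g_0$ (equivalently, the solution of the corresponding ODE on inner products on the Lie algebra). "$g(t)$ remains diagonal in the basis $Y_i$" means $g(t)(Y_i,Y_j)=0$ for all $i\ne j$ and all $t\ge0$ in its maximal interval of existence. *)

theory Defs
  imports "HOL-Analysis.Analysis"
begin

text \<open>
  A left-invariant metric on a Lie group is an inner product on its Lie algebra, and the Levi-Civita
  connection, curvature and Ricci tensor of such a metric are determined by their values on
  left-invariant vector fields, that is, on the Lie algebra. The type class euclidean_space is only
  used for finite-dimensionality and for writing down traces; its own inner product plays no
  geometric role.
\<close>

definition lie_bracket :: "('g::euclidean_space \<Rightarrow> 'g \<Rightarrow> 'g) \<Rightarrow> bool" where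
  "lie_bracket br \<longleftrightarrow> bilinear br \<and> (\<forall>x. br x x = 0) \<and>
     (\<forall>x y z. br x (br y z) + br y (br z x) + br z (br x y) = 0)"

definition inner_product :: "('g::euclidean_space \<Rightarrow> 'g \<Rightarrow> real) \<Rightarrow> bool" where
  "inner_product g \<longleftrightarrow> bilinear g \<and> (\<forall>x y. g x y = g y x) \<and> (\<forall>x. x \<noteq> 0 \<longrightarrow> g x x > 0)"

text \<open>
  For left-invariant \<open>y\<close> and \<open>z\<close> the function \<open>g y z\<close> is constant on the group, so its derivative
  along \<open>x\<close>, the left-hand side of the usual metric compatibility condition, vanishes.
\<close>

definition is_levi_civita ::
  "('g::euclidean_space \<Rightarrow> 'g \<Rightarrow> 'g) \<Rightarrow> ('g \<Rightarrow> 'g \<Rightarrow> real) \<Rightarrow> ('g \<Rightarrow> 'g \<Rightarrow> 'g) \<Rightarrow> bool" where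
  "is_levi_civita br g D \<longleftrightarrow> bilinear D \<and>
     (\<forall>x y. D x y - D y x = br x y) \<and>
     (\<forall>x y z. 0 = g (D x y) z + g y (D x z))"

definition levi_civita ::
  "('g::euclidean_space \<Rightarrow> 'g \<Rightarrow> 'g) \<Rightarrow> ('g \<Rightarrow> 'g \<Rightarrow> real) \<Rightarrow> 'g \<Rightarrow> 'g \<Rightarrow> 'g" where
  "levi_civita br g = (THE D. is_levi_civita br g D)"

definition riemann ::
  "('g::euclidean_space \<Rightarrow> 'g \<Rightarrow> 'g) \<Rightarrow> ('g \<Rightarrow> 'g \<Rightarrow> real) \<Rightarrow> 'g \<Rightarrow> 'g \<Rightarrow> 'g \<Rightarrow> 'g" where
  "riemann br g x y z =
     (let D = levi_civita br g in D x (D y z) - D y (D x z) - D (br x y) z)"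

definition linear_trace :: "('g::euclidean_space \<Rightarrow> 'g) \<Rightarrow> real" where
  "linear_trace f = (\<Sum>b\<in>Basis. f b \<bullet> b)"

definition ricci ::
  "('g::euclidean_space \<Rightarrow> 'g \<Rightarrow> 'g) \<Rightarrow> ('g \<Rightarrow> 'g \<Rightarrow> real) \<Rightarrow> 'g \<Rightarrow> 'g \<Rightarrow> real" where
  "ricci br g y z = linear_trace (\<lambda>x. riemann br g x y z)"

definition ricci_flow_on ::
  "('g::euclidean_space \<Rightarrow> 'g \<Rightarrow> 'g) \<Rightarrow> real set \<Rightarrow> (real \<Rightarrow> 'g \<Rightarrow> 'g \<Rightarrow> real) \<Rightarrow> bool" where
  "ricci_flow_on br I g \<longleftrightarrow> (\<forall>t\<in>I. inner_product (g t) \<and>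
     (\<forall>x y. ((\<lambda>s. g s x y) has_real_derivative - 2 * ricci br (g t) x y) (at t)))"

definition maximal_ricci_flow ::
  "('g::euclidean_space \<Rightarrow> 'g \<Rightarrow> 'g) \<Rightarrow> ('g \<Rightarrow> 'g \<Rightarrow> real) \<Rightarrow> real set \<Rightarrow>
   (real \<Rightarrow> 'g \<Rightarrow> 'g \<Rightarrow> real) \<Rightarrow> bool" where
  "maximal_ricci_flow br g0 I g \<longleftrightarrow>
     open I \<and> is_interval I \<and> 0 \<in> I \<and> ricci_flow_on br I g \<and> g 0 = g0 \<and>
     (\<forall>J h. open J \<and> is_interval J \<and> I \<subseteq> J \<and> ricci_flow_on br J h \<and> (\<forall>t\<in>I. h t = g t)
        \<longrightarrow> J = I)"

text \<open>The definite description in the definition of the Levi-Civita connection is justified.\<close>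

lemma inner_product_nondegenerate:
  assumes "inner_product g" and "\<And>z. g u z = g v z"
  shows "u = v"
proof (rule ccontr)
  assume "u \<noteq> v"
  then have "g (u - v) (u - v) > 0"
    using assms(1) by (simp add: inner_product_def)
  moreover have "g (u - v) (u - v) = g u (u - v) - g v (u - v)"
    using assms(1) by (simp add: inner_product_def bilinear_lsub)
  ultimately show False using assms(2) by simp
qed

lemma inner_product_represents:
  fixes g :: "'g::euclidean_space \<Rightarrow> 'g \<Rightarrow> real"
  assumes g: "inner_product g" and f: "linear f"
  shows "\<exists>v. \<forall>z. g v z = f z"
proof -
  have bil: "bilinear g" using g by (simp add: inner_product_def)
  have lin2: "linear (g v)" for v using bil by (simp add: bilinear_def)
  define L where "L v = (\<Sum>b\<in>Basis. g v b *\<^sub>R b)" for v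
  have Lb: "L v \<bullet> b = g v b" if "b \<in> Basis" for v b
    using that by (simp add: L_def)
  have "linear L"
    by (rule linearI; rule euclidean_eqI)
      (simp_all add: Lb inner_add_left bilinear_ladd[OF bil] bilinear_lmul[OF bil])
  moreover have "inj L"
  proof (rule injI)
    fix u v assume "L u = L v"
    then have "g u b = g v b" if "b \<in> Basis" for b
      using Lb[OF that, of u] Lb[OF that, of v] by simp
    then have "g u = g v"
      using linear_eq_stdbasis[OF lin2 lin2] by blast
    then show "u = v" using inner_product_nondegenerate[OF g] by simp
  qed
  ultimately have "surj L" using linear_injective_imp_surjective by blast
  then obtain v where v: "L v = (\<Sum>b\<in>Basis. f b *\<^sub>R b)" by (metis surjD)
  have "g v b = f b" if "b \<in> Basis" for b
    using Lb[OF that, of v] that by (simp add: v)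
  then have "g v = f"
    using linear_eq_stdbasis[OF lin2 f] by blast
  then show ?thesis by auto
qed

lemma levi_civita_koszul:
  assumes br: "lie_bracket br" and g: "inner_product g" and D: "is_levi_civita br g D"
  shows "2 * g (D x y) z = g (br x y) z - g (br y z) x + g (br z x) y"
proof -
  have bil: "bilinear g" and sym: "\<And>x y. g x y = g y x"
    using g by (auto simp: inner_product_def)
  have T: "br x y = D x y - D y x" for x y
    using D by (simp add: is_levi_civita_def)
  have M: "g (D x y) z = - g (D x z) y" for x y z
  proof -
    have "0 = g (D x y) z + g y (D x z)" using D by (simp only: is_levi_civita_def)
    then show ?thesis using sym[of y "D x z"] by linarith
  qed
  show ?thesis
    unfolding T bilinear_lsub[OF bil]
    using M[of x y z] M[of y x z] M[of z x y] by linarith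
qed

lemma ex1_levi_civita:
  assumes br: "lie_bracket br" and g: "inner_product g"
  shows "\<exists>!D. is_levi_civita br g D"
proof (rule ex_ex1I)
  have bg: "bilinear g" and sym: "\<And>x y. g x y = g y x"
    using g by (auto simp: inner_product_def)
  have bb: "bilinear br" and alt: "\<And>x. br x x = 0"
    using br by (auto simp: lie_bracket_def)
  have skew: "br x y = - br y x" for x y
    using alt[of "x + y"] alt[of x] alt[of y]
    by (simp add: bilinear_ladd[OF bb] bilinear_radd[OF bb] eq_neg_iff_add_eq_0 add.commute)
  note simps = bilinear_ladd[OF bb] bilinear_radd[OF bb] bilinear_lmul[OF bb] bilinear_rmul[OF bb]
    bilinear_ladd[OF bg] bilinear_radd[OF bg] bilinear_lmul[OF bg] bilinear_rmul[OF bg]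
  define K where "K x y z = (g (br x y) z - g (br y z) x + g (br z x) y) / 2" for x y z
  have "linear (K x y)" for x y
    by (rule linearI) (simp_all add: K_def simps field_simps)
  then have "\<forall>x y. \<exists>v. \<forall>z. g v z = K x y z"
    using inner_product_represents[OF g] by blast
  then obtain D where D: "\<And>x y z. g (D x y) z = K x y z" by metis
  note nd = inner_product_nondegenerate[OF g]
  have "bilinear D"
    unfolding bilinear_def
    by (intro conjI allI linearI; rule nd)
      (simp_all add: simps D, simp_all add: K_def simps field_simps)
  moreover have "D x y - D y x = br x y" for x y
  proof (rule nd)
    fix z
    show "g (D x y - D y x) z = g (br x y) z"
      using skew[of y x] skew[of z x] skew[of z y]
      by (simp add: bilinear_lsub[OF bg] bilinear_lneg[OF bg] D K_def field_simps)
  qed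
  moreover have "0 = g (D x y) z + g y (D x z)" for x y z
    using skew[of y x] skew[of z x] skew[of z y] sym[of y "D x z"]
    by (simp add: bilinear_lneg[OF bg] D K_def field_simps)
  ultimately show "\<exists>D. is_levi_civita br g D"
    by (auto simp: is_levi_civita_def)
next
  fix D E assume DE: "is_levi_civita br g D" "is_levi_civita br g E"
  have "D x y = E x y" for x y
  proof (rule inner_product_nondegenerate[OF g])
    fix z show "g (D x y) z = g (E x y) z"
      using levi_civita_koszul[OF br g DE(1), of x y z] levi_civita_koszul[OF br g DE(2), of x y z]
      by linarith
  qed
  then show "D = E" by blast
qed

lemma is_levi_civita_levi_civita:
  "lie_bracket br \<Longrightarrow> inner_product g \<Longrightarrow> is_levi_civita br g (levi_civita br g)"
  unfolding levi_civita_def using theI'[OF ex1_levi_civita] .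

end

theory Submission
  imports Defs
begin

text \<open>
  The brackets of the \<open>Y\<^sub>i\<close> depend only on \<open>\<alpha>\<close>, \<open>\<beta>\<close>, \<open>\<gamma>\<close>:
  \<open>[Y\<^sub>2,Y\<^sub>3] = Y\<^sub>4\<close>, \<open>[Y\<^sub>3,Y\<^sub>1] = Y\<^sub>2 - \<alpha> Y\<^sub>3 + \<beta> Y\<^sub>4\<close>,
  \<open>[Y\<^sub>1,Y\<^sub>2] = - \<alpha> Y\<^sub>2 + (\<alpha>\<^sup>2 - 1) Y\<^sub>3 + \<gamma> Y\<^sub>4\<close>.
  If the flow stays diagonal for a short time, the off-diagonal entries of the Ricci tensor vanish at
  time 0; the entries (1,2), (1,3), (2,3) then give the three conditions.

  Conversely, let \<open>V\<close> be the space of forms that are diagonal in the basis \<open>Y\<^sub>i\<close> and, if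
  \<open>\<alpha> \<noteq> 0\<close>, satisfy \<open>F Y\<^sub>2 Y\<^sub>2 = (1 - \<alpha>\<^sup>2) F Y\<^sub>3 Y\<^sub>3\<close>. There is a linear projection \<open>P\<close> onto \<open>V\<close>
  that maps metrics to metrics, and the Ricci tensor of a metric in \<open>V\<close> is in \<open>V\<close>. So
  \<open>(1 - P) Ric(g) = (1 - P) (Ric(g) - Ric(P g))\<close>, which is \<open>O(g - P g)\<close> because \<open>Ric\<close> is locally
  Lipschitz, and Gronwall's inequality applied to \<open>g - P g\<close> shows that the flow does not leave \<open>V\<close>.
\<close>

subsection \<open>Lipschitz dependence of the Ricci tensor on the metric\<close>

lemma bilinear_basis_expansion:
  fixes F :: "'a::euclidean_space \<Rightarrow> 'a \<Rightarrow> real"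
  assumes "bilinear F"
  shows "F x y = (\<Sum>b\<in>Basis. \<Sum>b'\<in>Basis. F b b' * ((x \<bullet> b) * (y \<bullet> b')))"
proof -
  have "F x y = F (\<Sum>b\<in>Basis. (x \<bullet> b) *\<^sub>R b) (\<Sum>b\<in>Basis. (y \<bullet> b) *\<^sub>R b)"
    by (simp add: euclidean_representation)
  also have "\<dots> = (\<Sum>b\<in>Basis. \<Sum>b'\<in>Basis. F b b' * ((x \<bullet> b) * (y \<bullet> b')))"
    by (simp add: bilinear_sum[OF assms] sum.cartesian_product[symmetric]
        bilinear_lmul[OF assms] bilinear_rmul[OF assms] mult_ac)
  finally show ?thesis .
qed

text \<open>The sum of the absolute entries on \<open>Basis\<close> serves as an operator norm
  bound. It ties finitely many entries, which can be differentiated in time, to the estimates on all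
  vectors that the Lipschitz bound asks for.\<close>

lemma bilinear_le_sum_Basis:
  fixes F :: "'a::euclidean_space \<Rightarrow> 'a \<Rightarrow> real"
  assumes "bilinear F"
  shows "\<bar>F x y\<bar> \<le> (\<Sum>b\<in>Basis. \<Sum>b'\<in>Basis. \<bar>F b b'\<bar>) * norm x * norm y"
proof -
  have "\<bar>F b b' * ((x \<bullet> b) * (y \<bullet> b'))\<bar> \<le> \<bar>F b b'\<bar> * (norm x * norm y)"
    if "b \<in> Basis" "b' \<in> Basis" for b b'
    unfolding abs_mult using that Basis_le_norm[of b x] Basis_le_norm[of b' y]
    by (intro mult_left_mono mult_mono) auto
  then have "\<bar>F x y\<bar> \<le> (\<Sum>b\<in>Basis. \<Sum>b'\<in>Basis. \<bar>F b b'\<bar> * (norm x * norm y))"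
    unfolding bilinear_basis_expansion[OF assms, of x y]
    by (intro order.trans[OF sum_abs] sum_mono) blast
  then show ?thesis by (simp add: sum_distrib_right mult.assoc)
qed

text \<open>On the compact product of \<open>K\<close> and the unit sphere, \<open>F t x x\<close>
  is continuous and, by definiteness, positive, so it has a positive minimum; homogeneity turns this
  into the lower bound. The upper bound comes from boundedness over \<open>K\<close> of the sum of
  the absolute entries.\<close>

lemma inner_product_compact_bounds:
  fixes F :: "real \<Rightarrow> 'a::euclidean_space \<Rightarrow> 'a \<Rightarrow> real"
  assumes K: "compact K" and F: "\<And>t. t \<in> K \<Longrightarrow> inner_product (F t)"
    and cont: "\<And>x y. continuous_on K (\<lambda>t. F t x y)"
  shows "\<exists>c>0. \<exists>M>0. \<forall>t\<in>K. \<forall>x y. c * (norm x)\<^sup>2 \<le> F t x x \<and> \<bar>F t x y\<bar> \<le> M * norm x * norm y"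
proof (cases "K = {}")
  case False
  have bil: "bilinear (F t)" if "t \<in> K" for t using F[OF that] by (simp add: inner_product_def)
  \<comment> \<open>Continuity in \<open>t\<close> is given for fixed vectors. Joint continuity of
    \<open>q\<close> is read off the finite expansion \<open>q'\<close>, which agrees with
    \<open>q\<close> on the compact product.\<close>
  define q where "q p = F (fst p) (snd p) (snd p)" for p
  define q' where "q' p = (\<Sum>b\<in>Basis. \<Sum>b'\<in>Basis. F (fst p) b b' * ((snd p \<bullet> b) * (snd p \<bullet> b')))"
    for p :: "real \<times> 'a"
  have qq: "q p = q' p" if "p \<in> K \<times> sphere 0 1" for p
    unfolding q_def q'_def using bilinear_basis_expansion[OF bil] that by auto
  have "continuous_on (K \<times> sphere 0 1) q'"
    unfolding q'_def
    by (intro continuous_intros continuous_on_compose2[OF cont]) auto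
  then have "continuous_on (K \<times> sphere 0 1) q"
    using qq by (simp cong: continuous_on_cong)
  moreover have "compact (K \<times> sphere (0::'a) 1)" using K by (intro compact_Times) auto
  moreover have "K \<times> sphere (0::'a) 1 \<noteq> {}" using False by simp
  ultimately obtain p where p: "p \<in> K \<times> sphere 0 1" "\<And>r. r \<in> K \<times> sphere 0 1 \<Longrightarrow> q p \<le> q r"
    using continuous_attains_inf by metis
  have "q p > 0" 
  proof -
    have "fst p \<in> K" "snd p \<noteq> 0" using p(1) by auto
    then show ?thesis using F[of "fst p"] by (simp add: q_def inner_product_def)
  qed
  moreover have "q p * (norm x)\<^sup>2 \<le> F t x x" if t: "t \<in> K" for t x
  proof (cases "x = 0")
    case True then show ?thesis using bilinear_lzero[OF bil[OF t]] by simp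
  next
    case False
    have "q p \<le> q (t, x /\<^sub>R norm x)" by (rule p(2)) (use False t in auto)
    also have "\<dots> = F t x x / (norm x)\<^sup>2"
      by (simp add: q_def bilinear_lmul[OF bil[OF t]] bilinear_rmul[OF bil[OF t]]
          power2_eq_square field_simps)
    finally show ?thesis using False by (simp add: field_simps)
  qed
  moreover have "continuous_on K (\<lambda>t. \<Sum>b\<in>Basis. \<Sum>b'\<in>Basis. \<bar>F t b b'\<bar>)"
    by (intro continuous_intros cont)
  then have "bounded ((\<lambda>t. \<Sum>b\<in>Basis. \<Sum>b'\<in>Basis. \<bar>F t b b'\<bar>) ` K)"
    using K compact_continuous_image compact_imp_bounded by blast
  then obtain M where M: "M > 0" "\<And>t. t \<in> K \<Longrightarrow> (\<Sum>b\<in>Basis. \<Sum>b'\<in>Basis. \<bar>F t b b'\<bar>) \<le> M"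
    unfolding bounded_pos by (force simp: abs_le_iff)
  moreover have "\<bar>F t x y\<bar> \<le> M * norm x * norm y" if t: "t \<in> K" for t x y
    by (rule order.trans[OF bilinear_le_sum_Basis[OF bil[OF t]]])
      (intro mult_right_mono M(2) t norm_ge_zero)
  ultimately show ?thesis by blast
qed (auto intro: exI[of _ 1])

text \<open>Test the Koszul formula against \<open>z = D x y\<close> itself: the left side is at
  least \<open>2 * c * (norm z)\<^sup>2\<close>, each of the three terms on the right is at most
  \<open>M * b * norm x * norm y * norm z\<close>, and one factor \<open>norm z\<close>
  cancels.\<close>

lemma levi_civita_norm_le:
  assumes br: "lie_bracket br" and g: "inner_product g"
    and b: "b \<ge> 0" "\<And>x y. norm (br x y) \<le> b * norm x * norm y"
    and c: "c > 0" "\<And>x. c * (norm x)\<^sup>2 \<le> g x x"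
    and M: "M \<ge> 0" "\<And>x y. \<bar>g x y\<bar> \<le> M * norm x * norm y"
  shows "norm (levi_civita br g x y) \<le> 3 * M * b / (2 * c) * norm x * norm y"
proof -
  define z where "z = levi_civita br g x y"
  have *: "\<bar>g (br u v) w\<bar> \<le> M * b * (norm u * norm v * norm w)" for u v w
  proof -
    have "\<bar>g (br u v) w\<bar> \<le> M * norm (br u v) * norm w" by (rule M)
    also have "\<dots> \<le> M * (b * norm u * norm v) * norm w"
      by (intro mult_right_mono mult_left_mono b M norm_ge_zero)
    finally show ?thesis by (simp add: mult_ac)
  qed
  have "2 * (c * (norm z)\<^sup>2) \<le> 2 * g z z" using c(2)[of z] by simp
  also have "\<dots> = g (br x y) z - g (br y z) x + g (br z x) y"
    unfolding z_def by (rule levi_civita_koszul[OF br g is_levi_civita_levi_civita[OF br g]])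
  also have "\<dots> \<le> 3 * (M * b * (norm x * norm y * norm z))"
    using *[of x y z] *[of y z x] *[of z x y] by (simp add: mult_ac)
  finally have "(2 * c * norm z) * norm z \<le> (3 * M * b * (norm x * norm y)) * norm z"
    by (simp add: power2_eq_square mult_ac)
  then have "2 * c * norm z \<le> 3 * M * b * (norm x * norm y)"
    using b M c by (cases "z = 0") auto
  then show ?thesis using c by (simp add: z_def field_simps)
qed

text \<open>Subtract the two Koszul formulas and test against the difference \<open>z\<close> of the
  connections. The three bracket terms give \<open>3 * b\<close>; exchanging \<open>g\<close> for
  \<open>h\<close> in front of the connection of \<open>h\<close> costs the term
  \<open>2 * N\<close>.\<close>

lemma levi_civita_diff_norm_le:
  assumes br: "lie_bracket br" and g: "inner_product g" and h: "inner_product h"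
    and b: "b \<ge> 0" "\<And>x y. norm (br x y) \<le> b * norm x * norm y"
    and c: "c > 0" "\<And>x. c * (norm x)\<^sup>2 \<le> g x x"
    and N: "\<And>x y. norm (levi_civita br h x y) \<le> N * norm x * norm y"
    and d: "d \<ge> 0" "\<And>x y. \<bar>g x y - h x y\<bar> \<le> d * norm x * norm y"
  shows "norm (levi_civita br g x y - levi_civita br h x y)
    \<le> d * (3 * b + 2 * N) / (2 * c) * norm x * norm y"
proof -
  define z where "z = levi_civita br g x y - levi_civita br h x y"
  have *: "\<bar>g (br u v) w - h (br u v) w\<bar> \<le> d * b * (norm u * norm v * norm w)" for u v w
  proof -
    have "\<bar>g (br u v) w - h (br u v) w\<bar> \<le> d * norm (br u v) * norm w" by (rule d)
    also have "\<dots> \<le> d * (b * norm u * norm v) * norm w"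
      by (intro mult_right_mono mult_left_mono b d norm_ge_zero)
    finally show ?thesis by (simp add: mult_ac)
  qed
  have **: "\<bar>g (levi_civita br h x y) z - h (levi_civita br h x y) z\<bar>
      \<le> d * N * (norm x * norm y * norm z)"
  proof -
    have "\<bar>g (levi_civita br h x y) z - h (levi_civita br h x y) z\<bar>
        \<le> d * norm (levi_civita br h x y) * norm z" by (rule d)
    also have "\<dots> \<le> d * (N * norm x * norm y) * norm z"
      by (intro mult_right_mono mult_left_mono N d norm_ge_zero)
    finally show ?thesis by (simp add: mult_ac)
  qed
  have "bilinear g" using g by (simp add: inner_product_def)
  then have split: "g z z = g (levi_civita br g x y) z - g (levi_civita br h x y) z"
    unfolding z_def by (rule bilinear_lsub)
  note kos = levi_civita_koszul[OF br g is_levi_civita_levi_civita[OF br g], of x y z]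
    levi_civita_koszul[OF br h is_levi_civita_levi_civita[OF br h], of x y z]
  have "2 * (c * (norm z)\<^sup>2) \<le> 2 * g z z" using c(2)[of z] by simp
  also have "\<dots> \<le> 3 * (d * b * (norm x * norm y * norm z)) + 2 * (d * N * (norm x * norm y * norm z))"
    unfolding split using kos ** *[of x y z] *[of y z x] *[of z x y] by (simp add: mult_ac)
  finally have "(2 * c * norm z) * norm z \<le> (d * (3 * b + 2 * N) * (norm x * norm y)) * norm z"
    by (simp add: power2_eq_square algebra_simps)
  \<comment> \<open>Needed for the case \<open>z = 0\<close>, where \<open>norm z\<close> cannot be
    cancelled. The product \<open>N * norm x * norm y\<close> is nonnegative because it bounds a
    norm.\<close>
  moreover have "0 \<le> d * (3 * b + 2 * N) * (norm x * norm y)"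
  proof -
    have "0 \<le> N * norm x * norm y" using N[of x y] norm_ge_zero order.trans by blast
    then have "0 \<le> d * (3 * b * (norm x * norm y) + 2 * (N * norm x * norm y))"
      using b d by auto
    then show ?thesis by (simp add: algebra_simps)
  qed
  ultimately have "2 * c * norm z \<le> d * (3 * b + 2 * N) * (norm x * norm y)"
    by (cases "z = 0") auto
  then show ?thesis using c by (simp add: z_def field_simps)
qed

lemma bilinear_levi_civita:
  "lie_bracket br \<Longrightarrow> inner_product g \<Longrightarrow> bilinear (levi_civita br g)"
  using is_levi_civita_levi_civita is_levi_civita_def by blast

text \<open>Apart from one bracket term the curvature is quadratic in the connection, and for
  metrics pinched between \<open>c\<close> and \<open>M\<close> the connection is bounded and
  depends on the metric in a Lipschitz way. The constant \<open>L\<close> is chosen before the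
  metrics, so a single one serves a whole compact time interval.\<close>

lemma ricci_lipschitz:
  fixes br :: "'g::euclidean_space \<Rightarrow> 'g \<Rightarrow> 'g"
  assumes br: "lie_bracket br" and c: "c > 0" and M: "M > 0"
  shows "\<exists>L\<ge>0. \<forall>g h d y z. inner_product g \<longrightarrow> inner_product h \<longrightarrow>
    (\<forall>x y. c * (norm x)\<^sup>2 \<le> g x x \<and> \<bar>g x y\<bar> \<le> M * norm x * norm y) \<longrightarrow>
    (\<forall>x y. c * (norm x)\<^sup>2 \<le> h x x \<and> \<bar>h x y\<bar> \<le> M * norm x * norm y) \<longrightarrow>
    d \<ge> 0 \<longrightarrow> (\<forall>x y. \<bar>g x y - h x y\<bar> \<le> d * norm x * norm y) \<longrightarrow>
    \<bar>ricci br g y z - ricci br h y z\<bar> \<le> L * d * norm y * norm z"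
proof -
  have "bilinear br" using br by (simp add: lie_bracket_def)
  then obtain b where b: "b > 0" "\<And>x y. norm (br x y) \<le> b * norm x * norm y"
    using bilinear_bounded_pos by blast
  \<comment> \<open>\<open>N\<close> bounds both connections and \<open>d * Q\<close> their
    difference. In \<open>L\<close>, the four products of connections cost \<open>Q * N\<close>
    each, the bracket term costs \<open>Q * b\<close>, and the trace contributes the
    dimension.\<close>
  define N where "N = 3 * M * b / (2 * c)"
  define Q where "Q = (3 * b + 2 * N) / (2 * c)"
  have N: "N \<ge> 0" and Q: "Q \<ge> 0" using b c M by (auto simp: N_def Q_def)
  define L where "L = real DIM('g) * (Q * (4 * N + b))"
  have "L \<ge> 0" using N Q b by (simp add: L_def)
  moreover have "\<bar>ricci br g y z - ricci br h y z\<bar> \<le> L * d * norm y * norm z"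
    if g: "inner_product g" and h: "inner_product h"
    and bg: "\<forall>x y. c * (norm x)\<^sup>2 \<le> g x x \<and> \<bar>g x y\<bar> \<le> M * norm x * norm y"
    and bh: "\<forall>x y. c * (norm x)\<^sup>2 \<le> h x x \<and> \<bar>h x y\<bar> \<le> M * norm x * norm y"
    and d: "d \<ge> 0" "\<forall>x y. \<bar>g x y - h x y\<bar> \<le> d * norm x * norm y" for g h d y z
  proof -
    define G where "G = levi_civita br g"
    define H where "H = levi_civita br h"
    define E where "E x y = G x y - H x y" for x y
    have NG: "norm (G x y) \<le> N * norm x * norm y" for x y
      unfolding G_def N_def by (rule levi_civita_norm_le) (use br g b c M bg in auto)
    have NH: "norm (H x y) \<le> N * norm x * norm y" for x y
      unfolding H_def N_def by (rule levi_civita_norm_le) (use br h b c M bh in auto)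
    have NE: "norm (E x y) \<le> d * Q * norm x * norm y" for x y
      using levi_civita_diff_norm_le[of br g h b c N d x y] br g h b c bg NH d
      unfolding E_def G_def H_def Q_def by simp
    have biG: "bilinear G" and biH: "bilinear H"
      unfolding G_def H_def using bilinear_levi_civita br g h by auto
    have *: "norm (riemann br g x y z - riemann br h x y z)
        \<le> d * (Q * (4 * N + b)) * (norm x * norm y * norm z)" for x
    proof -
      have 1: "norm (E u (G v w)) \<le> d * Q * N * (norm u * norm v * norm w)" for u v w
      proof -
        have "norm (E u (G v w)) \<le> d * Q * norm u * norm (G v w)" by (rule NE)
        also have "\<dots> \<le> d * Q * norm u * (N * norm v * norm w)"
          using d Q by (intro mult_left_mono NG) auto
        finally show ?thesis by (simp add: mult_ac)
      qed
      have 2: "norm (H u (E v w)) \<le> d * Q * N * (norm u * norm v * norm w)" for u v w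
      proof -
        have "norm (H u (E v w)) \<le> N * norm u * norm (E v w)" by (rule NH)
        also have "\<dots> \<le> N * norm u * (d * Q * norm v * norm w)"
          using N by (intro mult_left_mono NE) auto
        finally show ?thesis by (simp add: mult_ac)
      qed
      have 3: "norm (E (br u v) w) \<le> d * Q * b * (norm u * norm v * norm w)" for u v w
      proof -
        have "norm (E (br u v) w) \<le> d * Q * norm (br u v) * norm w" by (rule NE)
        also have "\<dots> \<le> d * Q * (b * norm u * norm v) * norm w"
          using d Q by (intro mult_left_mono mult_right_mono b) auto
        finally show ?thesis by (simp add: mult_ac)
      qed
      \<comment> \<open>A difference of products is split in the usual way:
        \<open>G G - H H = E G + H E\<close>, where \<open>E = G - H\<close>.\<close>
      have "riemann br g x y z - riemann br h x y z =
          E x (G y z) + H x (E y z) - E y (G x z) - H y (E x z) - E (br x y) z"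
        by (simp add: riemann_def Let_def G_def[symmetric] H_def[symmetric] E_def
            bilinear_rsub[OF biH])
      also have "norm \<dots> \<le> norm (E x (G y z)) + norm (H x (E y z)) + norm (E y (G x z))
          + norm (H y (E x z)) + norm (E (br x y) z)"
        by (intro norm_triangle_le_diff norm_triangle_le add_mono order.refl
            order.trans[OF norm_triangle_ineq4])
      also have "\<dots> \<le> d * (Q * (4 * N + b)) * (norm x * norm y * norm z)"
        using 1[of x y z] 2[of x y z] 1[of y x z] 2[of y x z] 3[of x y z]
        by (simp add: algebra_simps)
      finally show ?thesis .
    qed
    have "\<bar>ricci br g y z - ricci br h y z\<bar>
        = \<bar>\<Sum>x\<in>Basis. (riemann br g x y z - riemann br h x y z) \<bullet> x\<bar>"
      by (simp add: ricci_def linear_trace_def inner_diff_left sum_subtractf)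
    also have "\<dots> \<le> (\<Sum>x\<in>(Basis::'g set). d * (Q * (4 * N + b)) * (norm y * norm z))"
    proof (intro order.trans[OF sum_abs] sum_mono)
      fix x :: 'g assume x: "x \<in> Basis"
      have "\<bar>(riemann br g x y z - riemann br h x y z) \<bullet> x\<bar>
          \<le> norm (riemann br g x y z - riemann br h x y z)" using Basis_le_norm x by blast
      then show "\<bar>(riemann br g x y z - riemann br h x y z) \<bullet> x\<bar>
          \<le> d * (Q * (4 * N + b)) * (norm y * norm z)" using *[of x] x by simp
    qed
    also have "\<dots> = L * d * norm y * norm z" by (simp add: L_def mult_ac)
    finally show ?thesis .
  qed
  ultimately show ?thesis by blast
qed

subsection \<open>Subspaces invariant under the Ricci flow\<close>

text \<open>The function \<open>exp (- K * t) * f t\<close> vanishes at 0 and has nonpositive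
  derivative on the interval.\<close>

lemma gronwall_zero:
  fixes f :: "real \<Rightarrow> real"
  assumes T: "0 \<le> T" and d: "\<And>t. 0 \<le> t \<Longrightarrow> t \<le> T \<Longrightarrow> (f has_real_derivative f' t) (at t)"
    and le: "\<And>t. 0 \<le> t \<Longrightarrow> t \<le> T \<Longrightarrow> f' t \<le> K * f t" and f0: "f 0 = 0"
  shows "f T \<le> 0"
proof -
  have "\<exists>y. ((\<lambda>s. exp (- K * s) * f s) has_real_derivative y) (at t) \<and> y \<le> 0"
    if t: "0 \<le> t" "t \<le> T" for t
  proof (intro exI conjI)
    show "((\<lambda>s. exp (- K * s) * f s) has_real_derivative exp (- K * t) * (f' t - K * f t)) (at t)"
      by (rule derivative_eq_intros d t refl | simp add: algebra_simps)+
    show "exp (- K * t) * (f' t - K * f t) \<le> 0"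
      using le[OF t] by (simp add: mult_le_0_iff)
  qed
  then have "exp (- K * T) * f T \<le> exp (- K * 0) * f 0"
    by (intro DERIV_nonpos_imp_nonincreasing[OF T]) auto
  then show ?thesis using f0 by (simp add: mult_le_0_iff)
qed

text \<open>The prescribed form of \<open>P\<close>, a combination of evaluations at fixed vectors
  \<open>u k\<close>, \<open>v k\<close>, makes it linear in \<open>F\<close> and lets it commute
  with the time derivative. The other conditions on \<open>P\<close> concern inner products only,
  since the Ricci tensor is controlled only there.\<close>

lemma ricci_flow_preserves_projection:
  fixes br :: "'g::euclidean_space \<Rightarrow> 'g \<Rightarrow> 'g" and c :: "'k \<Rightarrow> 'g \<Rightarrow> 'g \<Rightarrow> real"
  assumes br: "lie_bracket br" and flow: "ricci_flow_on br {0..T} g" and T: "0 \<le> T"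
    and P: "\<And>F x y. P F x y = (\<Sum>k\<in>S. c k x y * F (u k) (v k))"
    and inner: "\<And>h. inner_product h \<Longrightarrow> inner_product (P h)"
    and idem: "\<And>h. inner_product h \<Longrightarrow> P (P h) = P h"
    and tangent: "\<And>h. inner_product h \<Longrightarrow> P h = h \<Longrightarrow> P (ricci br h) = ricci br h"
    and g0: "P (g 0) = g 0"
  shows "P (g T) = g T"
proof -
  have ip: "inner_product (g t)" and
    dg: "((\<lambda>s. g s x y) has_real_derivative - 2 * ricci br (g t) x y) (at t)"
    if "t \<in> {0..T}" for t x y
    using flow that by (auto simp: ricci_flow_on_def)
  have cont: "continuous_on {0..T} (\<lambda>t. g t x y)" for x y
    using dg DERIV_isCont by (intro continuous_at_imp_continuous_on) blast
  have contP: "continuous_on {0..T} (\<lambda>t. P (g t) x y)" for x y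
    unfolding P by (intro continuous_intros cont)
  obtain c1 M1 where c1: "c1 > 0" "M1 > 0" "\<And>t x y. t \<in> {0..T} \<Longrightarrow>
      c1 * (norm x)\<^sup>2 \<le> g t x x \<and> \<bar>g t x y\<bar> \<le> M1 * norm x * norm y"
    using inner_product_compact_bounds[of "{0..T}" g] ip cont by auto
  obtain c2 M2 where c2: "c2 > 0" "M2 > 0" "\<And>t x y. t \<in> {0..T} \<Longrightarrow>
      c2 * (norm x)\<^sup>2 \<le> P (g t) x x \<and> \<bar>P (g t) x y\<bar> \<le> M2 * norm x * norm y"
    using inner_product_compact_bounds[of "{0..T}" "\<lambda>t. P (g t)"] inner[OF ip] contP by auto
  \<comment> \<open>Common pinching constants for \<open>g t\<close> and \<open>P (g t)\<close> on
    the whole interval, so that the Lipschitz estimate can compare the two.\<close>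
  define c0 where "c0 = min c1 c2"
  define M0 where "M0 = max M1 M2"
  have cM: "c0 > 0" "M0 > 0" using c1 c2 by (auto simp: c0_def M0_def)
  have weaken: "c0 * (norm x)\<^sup>2 \<le> F x x \<and> \<bar>F x y\<bar> \<le> M0 * norm x * norm y"
    if "c' * (norm x)\<^sup>2 \<le> F x x \<and> \<bar>F x y\<bar> \<le> M' * norm x * norm y" "c0 \<le> c'" "M' \<le> M0"
    for F :: "'g \<Rightarrow> 'g \<Rightarrow> real" and x y c' M'
  proof -
    have "c0 * (norm x)\<^sup>2 \<le> c' * (norm x)\<^sup>2"
      using that by (intro mult_right_mono) auto
    moreover have "M' * norm x * norm y \<le> M0 * norm x * norm y"
      using that by (intro mult_right_mono) auto
    ultimately show ?thesis using that by linarith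
  qed
  obtain L where L: "L \<ge> 0" "\<And>g h d y z. inner_product g \<Longrightarrow> inner_product h \<Longrightarrow>
    (\<And>x y. c0 * (norm x)\<^sup>2 \<le> g x x \<and> \<bar>g x y\<bar> \<le> M0 * norm x * norm y) \<Longrightarrow>
    (\<And>x y. c0 * (norm x)\<^sup>2 \<le> h x x \<and> \<bar>h x y\<bar> \<le> M0 * norm x * norm y) \<Longrightarrow>
    d \<ge> 0 \<Longrightarrow> (\<And>x y. \<bar>g x y - h x y\<bar> \<le> d * norm x * norm y) \<Longrightarrow>
    \<bar>ricci br g y z - ricci br h y z\<bar> \<le> L * d * norm y * norm z"
    using ricci_lipschitz[OF br cM] by auto
  \<comment> \<open>\<open>E\<close> is the defect of \<open>g t\<close> from the invariant
    subspace, \<open>e\<close> its size in the role of the distance \<open>d\<close>, and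
    \<open>R\<close> the resulting change of the Ricci tensor.\<close>
  define E where "E t x y = g t x y - P (g t) x y" for t x y
  define e where "e t = (\<Sum>b\<in>Basis. \<Sum>b'\<in>Basis. \<bar>E t b b'\<bar>)" for t
  define R where "R t x y = ricci br (g t) x y - ricci br (P (g t)) x y" for t x y
  have e0: "e t \<ge> 0" for t by (auto simp: e_def intro!: sum_nonneg)
  have biE: "bilinear (E t)" if "t \<in> {0..T}" for t
    using ip[OF that] inner[OF ip[OF that]]
    by (auto simp: inner_product_def bilinear_def E_def[abs_def] intro: linear_compose_sub)
  have lipR: "\<bar>R t y z\<bar> \<le> L * e t * norm y * norm z" if t: "t \<in> {0..T}" for t y z
    unfolding R_def
  proof (rule L(2)[OF ip[OF t] inner[OF ip[OF t]] _ _ e0])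
    show "\<bar>g t x y - P (g t) x y\<bar> \<le> e t * norm x * norm y" for x y
      using bilinear_le_sum_Basis[OF biE[OF t]] unfolding E_def e_def .
    show "c0 * (norm x)\<^sup>2 \<le> g t x x \<and> \<bar>g t x y\<bar> \<le> M0 * norm x * norm y" for x y
      by (rule weaken[OF c1(3)[OF t]]) (auto simp: c0_def M0_def)
    show "c0 * (norm x)\<^sup>2 \<le> P (g t) x x \<and> \<bar>P (g t) x y\<bar> \<le> M0 * norm x * norm y" for x y
      by (rule weaken[OF c2(3)[OF t]]) (auto simp: c0_def M0_def)
  qed
  have dE: "((\<lambda>s. E s x y) has_real_derivative - 2 * (R t x y - P (R t) x y)) (at t)"
    if t: "t \<in> {0..T}" for t x y
  proof -
    have "((\<lambda>s. E s x y) has_real_derivative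
        (- 2 * ricci br (g t) x y - (\<Sum>k\<in>S. c k x y * (- 2 * ricci br (g t) (u k) (v k))))) (at t)"
      unfolding E_def P by (intro derivative_intros DERIV_cmult dg t)
    also have "- 2 * ricci br (g t) x y - (\<Sum>k\<in>S. c k x y * (- 2 * ricci br (g t) (u k) (v k))) =
        - 2 * (ricci br (g t) x y - P (ricci br (g t)) x y)"
      unfolding P by (simp add: sum_negf sum_distrib_left algebra_simps)
    \<comment> \<open>\<open>P\<close> fixes \<open>ricci br (P (g t))\<close>, so subtracting this
      tensor from \<open>ricci br (g t)\<close> leaves the component along 1 - \<open>P\<close>
      unchanged. What remains is governed by \<open>R\<close>, hence by \<open>e t\<close>.\<close>
    also have "\<dots> = - 2 * (R t x y - P (R t) x y)"
    proof -
      have "P (ricci br (P (g t))) x y = ricci br (P (g t)) x y"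
        using tangent inner idem ip t by metis
      moreover have "P (R t) x y = P (ricci br (g t)) x y - P (ricci br (P (g t))) x y"
        unfolding P R_def by (simp add: sum_subtractf algebra_simps)
      ultimately show ?thesis by (simp add: R_def)
    qed
    finally show ?thesis .
  qed
  \<comment> \<open>The first summand accounts for \<open>R t x y\<close>, the sum over
    \<open>S\<close> for \<open>P (R t) x y\<close>, each evaluation being estimated by
    \<open>lipR\<close>.\<close>
  define n where "n x y = norm x * norm y + (\<Sum>k\<in>S. \<bar>c k x y\<bar> * (norm (u k) * norm (v k)))"
    for x y
  have boundE: "\<bar>R t x y - P (R t) x y\<bar> \<le> L * e t * n x y" if t: "t \<in> {0..T}" for t x y
  proof -
    have "\<bar>P (R t) x y\<bar> \<le> (\<Sum>k\<in>S. L * e t * (\<bar>c k x y\<bar> * (norm (u k) * norm (v k))))"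
      unfolding P
    proof (intro order.trans[OF sum_abs] sum_mono)
      fix k
      have "\<bar>c k x y * R t (u k) (v k)\<bar> \<le> \<bar>c k x y\<bar> * (L * e t * norm (u k) * norm (v k))"
        unfolding abs_mult by (intro mult_left_mono lipR t) auto
      then show "\<bar>c k x y * R t (u k) (v k)\<bar> \<le> L * e t * (\<bar>c k x y\<bar> * (norm (u k) * norm (v k)))"
        by (simp add: mult_ac)
    qed
    then show ?thesis using lipR[OF t, of x y]
      by (simp add: n_def sum_distrib_left algebra_simps)
  qed
  \<comment> \<open>Gronwall is applied to the sum of squares, which stays differentiable where
    entries of \<open>E\<close> vanish, unlike the sum of absolute values \<open>e\<close>.\<close>
  define \<phi> where "\<phi> t = (\<Sum>b\<in>Basis. \<Sum>b'\<in>Basis. (E t b b')\<^sup>2)" for t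
  define \<phi>' where "\<phi>' t =
    (\<Sum>b\<in>Basis. \<Sum>b'\<in>Basis. 2 * E t b b' * (- 2 * (R t b b' - P (R t) b b')))" for t
  define m where "m = (\<Sum>b\<in>(Basis::'g set). \<Sum>b'\<in>(Basis::'g set). n b b')"
  define D where "D = real DIM('g)"
  have n0: "n x y \<ge> 0" for x y
    by (auto simp: n_def intro!: sum_nonneg add_nonneg_nonneg mult_nonneg_nonneg)
  have nm: "n b b' \<le> m" if "b \<in> Basis" "b' \<in> Basis" for b b'
  proof -
    have "n b b' \<le> (\<Sum>b'\<in>Basis. n b b')"
      using that n0 by (intro member_le_sum) auto
    also have "\<dots> \<le> m" unfolding m_def
      using that n0 by (intro member_le_sum[where f="\<lambda>b. \<Sum>b'\<in>Basis. n b b'"] sum_nonneg) auto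
    finally show ?thesis .
  qed
  have m0: "m \<ge> 0" unfolding m_def using n0 by (intro sum_nonneg) auto
  have "\<phi> T \<le> 0"
  proof (rule gronwall_zero[OF T])
    show "\<phi> 0 = 0" by (simp add: \<phi>_def E_def g0)
    fix t assume "0 \<le> t" "t \<le> T"
    then have t: "t \<in> {0..T}" by simp
    show "(\<phi> has_real_derivative \<phi>' t) (at t)"
      unfolding \<phi>_def[abs_def] \<phi>'_def
      by (intro DERIV_sum DERIV_power[THEN DERIV_cong, OF dE[OF t]]) (simp add: mult_ac)
    have "\<phi>' t \<le> (\<Sum>b\<in>(Basis::'g set). \<Sum>b'\<in>(Basis::'g set). 4 * L * m * e t * \<bar>E t b b'\<bar>)"
      unfolding \<phi>'_def
    proof (intro sum_mono)
      fix b b' :: 'g assume b: "b \<in> Basis" "b' \<in> Basis"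
      have "\<bar>R t b b' - P (R t) b b'\<bar> \<le> L * e t * m"
        using boundE[OF t, of b b'] mult_left_mono[OF nm[OF b], of "L * e t"] L(1) e0[of t] by auto
      then have "\<bar>E t b b'\<bar> * \<bar>R t b b' - P (R t) b b'\<bar> \<le> \<bar>E t b b'\<bar> * (L * e t * m)"
        by (intro mult_left_mono) auto
      moreover have "2 * E t b b' * (- 2 * (R t b b' - P (R t) b b'))
          \<le> 4 * (\<bar>E t b b'\<bar> * \<bar>R t b b' - P (R t) b b'\<bar>)"
        using abs_ge_minus_self[of "E t b b' * (R t b b' - P (R t) b b')"]
        by (simp only: abs_mult[symmetric])
      ultimately show "2 * E t b b' * (- 2 * (R t b b' - P (R t) b b')) \<le> 4 * L * m * e t * \<bar>E t b b'\<bar>"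
        by (simp add: mult_ac)
    qed
    also have "\<dots> = 4 * L * m * (e t)\<^sup>2"
      by (simp add: sum_distrib_left[symmetric] e_def power2_eq_square)
    \<comment> \<open>Cauchy-Schwarz, once for each of the two sums over \<open>Basis\<close>, gives
      a factor \<open>D\<close> each time and brings the estimate back to
      \<open>\<phi>\<close>.\<close>
    also have "\<dots> \<le> 4 * L * m * (D\<^sup>2 * \<phi> t)"
    proof (intro mult_left_mono)
      have "(e t)\<^sup>2 \<le> D * (\<Sum>b\<in>(Basis::'g set). (\<Sum>b'\<in>(Basis::'g set). \<bar>E t b b'\<bar>)\<^sup>2)"
        unfolding e_def D_def
        using sum_squared_le_sum_of_squares[of "\<lambda>b. \<Sum>b'\<in>Basis. \<bar>E t b b'\<bar>" "Basis::'g set"]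
        by (simp add: mult.commute)
      also have "\<dots> \<le> D * (\<Sum>b\<in>(Basis::'g set). D * (\<Sum>b'\<in>(Basis::'g set). \<bar>E t b b'\<bar>\<^sup>2))"
        unfolding D_def
        using sum_squared_le_sum_of_squares[of "\<lambda>b'. \<bar>E t b b'\<bar>" "Basis::'g set" for b]
        by (intro mult_left_mono sum_mono) (simp_all add: mult.commute)
      also have "\<dots> = D\<^sup>2 * \<phi> t"
        by (simp add: \<phi>_def sum_distrib_left power2_eq_square mult_ac)
      finally show "(e t)\<^sup>2 \<le> D\<^sup>2 * \<phi> t" .
      show "0 \<le> 4 * L * m" using L m0 by simp
    qed
    finally show "\<phi>' t \<le> 4 * L * m * D\<^sup>2 * \<phi> t" by (simp add: mult_ac)
  qed
  have E0: "E T b b' = 0" if "b \<in> Basis" "b' \<in> Basis" for b b'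
  proof -
    have "\<phi> T = 0" using \<open>\<phi> T \<le> 0\<close> unfolding \<phi>_def
      by (intro antisym sum_nonneg) auto
    then have "(\<Sum>b'\<in>(Basis::'g set). (E T b b')\<^sup>2) = 0" using that
      unfolding \<phi>_def by (subst (asm) sum_nonneg_eq_0_iff) (auto intro: sum_nonneg)
    then show ?thesis using that
      by (subst (asm) sum_nonneg_eq_0_iff) auto
  qed
  have "T \<in> {0..T}" using T by simp
  then have "E T x y = 0" for x y
    using bilinear_basis_expansion[OF biE, of T x y] E0 by simp
  then show ?thesis by (intro ext) (simp add: E_def)
qed

subsection \<open>The Ricci tensor in an orthogonal frame\<close>

lemma bilinear_sum_scaleR:
  assumes "bilinear F"
  shows bilinear_lsum_scaleR: "F (\<Sum>k\<in>J. w k *\<^sub>R f k) y = (\<Sum>k\<in>J. w k *\<^sub>R F (f k) y)"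
    and bilinear_rsum_scaleR: "F y (\<Sum>k\<in>J. w k *\<^sub>R f k) = (\<Sum>k\<in>J. w k *\<^sub>R F y (f k))"
proof -
  have l: "linear (\<lambda>x. F x y)" and r: "linear (F y)"
    using assms by (auto simp: bilinear_def)
  show "F (\<Sum>k\<in>J. w k *\<^sub>R f k) y = (\<Sum>k\<in>J. w k *\<^sub>R F (f k) y)"
    by (simp add: linear_sum[OF l] linear_scale[OF l])
  show "F y (\<Sum>k\<in>J. w k *\<^sub>R f k) = (\<Sum>k\<in>J. w k *\<^sub>R F y (f k))"
    by (simp add: linear_sum[OF r] linear_scale[OF r])
qed

text \<open>Both sides are linear in \<open>x\<close>, and orthogonality makes them agree on the
  spanning vectors \<open>Y j\<close>.\<close>

lemma orthogonal_frame_expansion: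
  fixes h :: "'g::euclidean_space \<Rightarrow> 'g \<Rightarrow> real"
  assumes h: "inner_product h" and J: "finite J" and span: "span (Y ` J) = UNIV"
    and orth: "\<And>i j. i \<in> J \<Longrightarrow> j \<in> J \<Longrightarrow> h (Y i) (Y j) = (if i = j then l i else 0)"
    and l: "\<And>i. i \<in> J \<Longrightarrow> l i > 0"
  shows "x = (\<Sum>i\<in>J. (h x (Y i) / l i) *\<^sub>R Y i)"
proof -
  have bh: "bilinear h" using h by (simp add: inner_product_def)
  have "linear (\<lambda>x. \<Sum>i\<in>J. (h x (Y i) / l i) *\<^sub>R Y i)"
    by (intro linear_compose_sum ballI linearI)
      (simp_all add: bilinear_ladd[OF bh] bilinear_lmul[OF bh] add_divide_distrib scaleR_add_left)
  moreover have "id y = (\<Sum>i\<in>J. (h y (Y i) / l i) *\<^sub>R Y i)" if y: "y \<in> Y ` J" for y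
  proof -
    obtain j where j: "j \<in> J" "y = Y j" using y by blast
    have "(\<Sum>i\<in>J. (h y (Y i) / l i) *\<^sub>R Y i) = (\<Sum>i\<in>J. if i = j then Y i else 0)"
    proof (rule sum.cong)
      fix i assume i: "i \<in> J"
      show "(h y (Y i) / l i) *\<^sub>R Y i = (if i = j then Y i else 0)"
        using orth[OF j(1) i] l[OF i] j by auto
    qed simp
    then show ?thesis using j J by (simp add: sum.delta)
  qed
  ultimately have "id x = (\<Sum>i\<in>J. (h x (Y i) / l i) *\<^sub>R Y i)"
    using linear_eq_on_span[of id "\<lambda>x. \<Sum>i\<in>J. (h x (Y i) / l i) *\<^sub>R Y i" "Y ` J" x]
      linear_id span by auto
  then show ?thesis by (simp only: id_apply)
qed

text \<open>Independence of the trace from the basis: expand each \<open>b\<close> in the frame,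
  exchange the sums, and reassemble \<open>f (Y i)\<close> from its coordinates on
  \<open>Basis\<close>.\<close>

lemma linear_trace_orthogonal_frame:
  fixes h :: "'g::euclidean_space \<Rightarrow> 'g \<Rightarrow> real"
  assumes h: "inner_product h" and J: "finite J" and span: "span (Y ` J) = UNIV"
    and orth: "\<And>i j. i \<in> J \<Longrightarrow> j \<in> J \<Longrightarrow> h (Y i) (Y j) = (if i = j then l i else 0)"
    and l: "\<And>i. i \<in> J \<Longrightarrow> l i > 0"
    and f: "linear f"
  shows "linear_trace f = (\<Sum>i\<in>J. h (f (Y i)) (Y i) / l i)"
proof -
  have bh: "bilinear h" using h by (simp add: inner_product_def)
  have *: "f b = (\<Sum>i\<in>J. (h b (Y i) / l i) *\<^sub>R f (Y i))" for b
  proof -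
    have "f b = f (\<Sum>i\<in>J. (h b (Y i) / l i) *\<^sub>R Y i)"
      by (rule arg_cong[OF orthogonal_frame_expansion[OF h J span orth l]])
    also have "\<dots> = (\<Sum>i\<in>J. (h b (Y i) / l i) *\<^sub>R f (Y i))"
      by (simp add: linear_sum[OF f] linear_scale[OF f])
    finally show ?thesis .
  qed
  have "linear_trace f = (\<Sum>b\<in>Basis. \<Sum>i\<in>J. h b (Y i) / l i * (f (Y i) \<bullet> b))"
    unfolding linear_trace_def
  proof (rule sum.cong[OF refl])
    fix b :: 'g
    show "f b \<bullet> b = (\<Sum>i\<in>J. h b (Y i) / l i * (f (Y i) \<bullet> b))"
      by (subst *[of b]) (simp add: inner_sum_left)
  qed
  also have "\<dots> = (\<Sum>i\<in>J. \<Sum>b\<in>Basis. h b (Y i) / l i * (f (Y i) \<bullet> b))"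
    by (rule sum.swap)
  also have "\<dots> = (\<Sum>i\<in>J. h (f (Y i)) (Y i) / l i)"
  proof (rule sum.cong)
    fix i
    have "h (f (Y i)) (Y i) = h (\<Sum>b\<in>Basis. (f (Y i) \<bullet> b) *\<^sub>R b) (Y i)"
      by (simp add: euclidean_representation)
    also have "\<dots> = (\<Sum>b\<in>Basis. (f (Y i) \<bullet> b) * h b (Y i))"
      by (simp add: bilinear_lsum_scaleR[OF bh])
    finally show "(\<Sum>b\<in>Basis. h b (Y i) / l i * (f (Y i) \<bullet> b)) = h (f (Y i)) (Y i) / l i"
      by (simp add: sum_divide_distrib mult_ac)
  qed simp
  finally show ?thesis .
qed

lemma bilinear_ricci:
  assumes br: "lie_bracket br" and h: "inner_product h"
  shows "bilinear (ricci br h)"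
proof -
  have bb: "bilinear br" using br by (simp add: lie_bracket_def)
  note bD = bilinear_levi_civita[OF br h]
  show ?thesis
    unfolding bilinear_def
    by (intro conjI allI linearI)
      (simp_all add: ricci_def riemann_def Let_def linear_trace_def
        bilinear_ladd[OF bb] bilinear_radd[OF bb] bilinear_lmul[OF bb] bilinear_rmul[OF bb]
        bilinear_ladd[OF bD] bilinear_radd[OF bD] bilinear_lmul[OF bD] bilinear_rmul[OF bD]
        inner_simps sum.distrib sum_subtractf sum_distrib_left algebra_simps)
qed

text \<open>By the Koszul formula, \<open>\<Gamma> i j k\<close> is the coefficient of
  \<open>Y k\<close> in the covariant derivative of \<open>Y j\<close> along \<open>Y i\<close>. The
  three products in the sum are the \<open>Y i\<close> coefficients of the three terms of the
  curvature applied to \<open>Y i\<close>, \<open>Y p\<close>, \<open>Y q\<close>.\<close>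

lemma ricci_orthogonal_frame:
  fixes h :: "'g::euclidean_space \<Rightarrow> 'g \<Rightarrow> real" and Y :: "'i \<Rightarrow> 'g"
    and c \<Gamma> :: "'i \<Rightarrow> 'i \<Rightarrow> 'i \<Rightarrow> real"
  assumes br: "lie_bracket br" and h: "inner_product h"
    and J: "finite J" and span: "span (Y ` J) = UNIV"
    and orth: "\<And>i j. i \<in> J \<Longrightarrow> j \<in> J \<Longrightarrow> h (Y i) (Y j) = (if i = j then l i else 0)"
    and l: "\<And>i. i \<in> J \<Longrightarrow> l i > 0"
    and c: "\<And>i j. i \<in> J \<Longrightarrow> j \<in> J \<Longrightarrow> br (Y i) (Y j) = (\<Sum>k\<in>J. c i j k *\<^sub>R Y k)"
    and \<Gamma>: "\<And>i j k. \<Gamma> i j k = (c i j k * l k - c j k i * l i + c k i j * l j) / (2 * l k)"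
    and p: "p \<in> J" and q: "q \<in> J"
  shows "ricci br h (Y p) (Y q) =
    (\<Sum>i\<in>J. \<Sum>m\<in>J. \<Gamma> p q m * \<Gamma> i m i - \<Gamma> i q m * \<Gamma> p m i - c i p m * \<Gamma> m q i)"
proof -
  have bh: "bilinear h" using h by (simp add: inner_product_def)
  have bb: "bilinear br" using br by (simp add: lie_bracket_def)
  define D where "D = levi_civita br h"
  have bD: "bilinear D" unfolding D_def by (rule bilinear_levi_civita[OF br h])
  have comp: "h (\<Sum>k\<in>J. w k *\<^sub>R Y k) (Y i) = w i * l i" if i: "i \<in> J" for w i
  proof -
    have "h (\<Sum>k\<in>J. w k *\<^sub>R Y k) (Y i) = (\<Sum>k\<in>J. w k * h (Y k) (Y i))"
      by (simp add: bilinear_lsum_scaleR[OF bh])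
    also have "\<dots> = (\<Sum>k\<in>J. if k = i then w k * l k else 0)"
      using i by (intro sum.cong) (auto simp: orth)
    finally show ?thesis using i J by (simp add: sum.delta)
  qed
  have DY: "D (Y i) (Y j) = (\<Sum>k\<in>J. \<Gamma> i j k *\<^sub>R Y k)" if i: "i \<in> J" and j: "j \<in> J" for i j
  proof -
    have "h (D (Y i) (Y j)) (Y k) / l k = \<Gamma> i j k" if k: "k \<in> J" for k
    proof -
      have "2 * h (D (Y i) (Y j)) (Y k) = c i j k * l k - c j k i * l i + c k i j * l j"
        using levi_civita_koszul[OF br h is_levi_civita_levi_civita[OF br h], of "Y i" "Y j" "Y k"]
        by (simp add: D_def c comp i j k)
      then show ?thesis using l[OF k] by (simp add: \<Gamma> field_simps)
    qed
    moreover have "D (Y i) (Y j) = (\<Sum>k\<in>J. (h (D (Y i) (Y j)) (Y k) / l k) *\<^sub>R Y k)"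
      by (rule orthogonal_frame_expansion[OF h J span orth l])
    ultimately show ?thesis by (metis (no_types, lifting) sum.cong)
  qed
  have Dr: "D x (\<Sum>k\<in>J. w k *\<^sub>R Y k) = (\<Sum>k\<in>J. w k *\<^sub>R D x (Y k))"
    and Dl: "D (\<Sum>k\<in>J. w k *\<^sub>R Y k) x = (\<Sum>k\<in>J. w k *\<^sub>R D (Y k) x)" for x w
    by (rule bilinear_sum_scaleR[OF bD])+
  have hs: "h (\<Sum>k\<in>J. w k *\<^sub>R f k) x = (\<Sum>k\<in>J. w k * h (f k) x)" for w f x
    by (simp add: bilinear_lsum_scaleR[OF bh])
  have "linear (\<lambda>x. riemann br h x (Y p) (Y q))"
    by (rule linearI) (simp_all add: riemann_def Let_def D_def[symmetric]
        bilinear_ladd[OF bb] bilinear_lmul[OF bb] bilinear_ladd[OF bD] bilinear_radd[OF bD]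
        bilinear_lmul[OF bD] bilinear_rmul[OF bD] algebra_simps)
  then have "ricci br h (Y p) (Y q) = (\<Sum>i\<in>J. h (riemann br h (Y i) (Y p) (Y q)) (Y i) / l i)"
    unfolding ricci_def using linear_trace_orthogonal_frame[of h J Y l] h J span orth l by blast
  also have "\<dots> = (\<Sum>i\<in>J. \<Sum>m\<in>J. \<Gamma> p q m * \<Gamma> i m i - \<Gamma> i q m * \<Gamma> p m i - c i p m * \<Gamma> m q i)"
  proof (rule sum.cong)
    fix i assume i: "i \<in> J"
    have l0: "l i \<noteq> 0" using l[OF i] by simp
    have "h (riemann br h (Y i) (Y p) (Y q)) (Y i) =
        (\<Sum>m\<in>J. \<Gamma> p q m * h (D (Y i) (Y m)) (Y i)) - (\<Sum>m\<in>J. \<Gamma> i q m * h (D (Y p) (Y m)) (Y i))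
        - (\<Sum>m\<in>J. c i p m * h (D (Y m) (Y q)) (Y i))"
      by (simp add: riemann_def Let_def D_def[symmetric] bilinear_lsub[OF bh]
          DY[OF p q] DY[OF i q] c[OF i p] Dr Dl hs)
    also have "\<dots> = (\<Sum>m\<in>J. \<Gamma> p q m * \<Gamma> i m i - \<Gamma> i q m * \<Gamma> p m i - c i p m * \<Gamma> m q i) * l i"
      by (simp add: DY comp i p q sum_subtractf sum_distrib_right left_diff_distrib mult.assoc)
    finally show "h (riemann br h (Y i) (Y p) (Y q)) (Y i) / l i =
        (\<Sum>m\<in>J. \<Gamma> p q m * \<Gamma> i m i - \<Gamma> i q m * \<Gamma> p m i - c i p m * \<Gamma> m q i)"
      using l0 by simp
  qed simp
  finally show ?thesis .
qed

subsection \<open>The four-dimensional Lie algebra\<close>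

text \<open>Only the pairs \<open>(2,3)\<close>, \<open>(3,1)\<close>, \<open>(1,2)\<close> are listed; the structure constants are the
  antisymmetrisation in \<open>i\<close> and \<open>j\<close>.\<close>

definition frame_bracket :: "real \<Rightarrow> real \<Rightarrow> real \<Rightarrow> nat \<Rightarrow> nat \<Rightarrow> nat \<Rightarrow> real" where
  "frame_bracket \<alpha> \<beta> \<gamma> i j k =
    (if i = 2 \<and> j = 3 then (if k = 4 then 1 else 0)
     else if i = 3 \<and> j = 1 then
       (if k = 2 then 1 else if k = 3 then - \<alpha> else if k = 4 then \<beta> else 0)
     else if i = 1 \<and> j = 2 then
       (if k = 2 then - \<alpha> else if k = 3 then \<alpha>\<^sup>2 - 1 else if k = 4 then \<gamma> else 0)
     else 0)"

definition adapted_frame ::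
  "('g::euclidean_space \<Rightarrow> 'g \<Rightarrow> 'g) \<Rightarrow> (nat \<Rightarrow> 'g) \<Rightarrow> real \<Rightarrow> real \<Rightarrow> real \<Rightarrow> bool" where
  "adapted_frame br Y \<alpha> \<beta> \<gamma> \<longleftrightarrow> span (Y ` {1..4}) = UNIV \<and>
    (\<forall>i\<in>{1..4}. \<forall>j\<in>{1..4}. br (Y i) (Y j) =
      (\<Sum>k\<in>{1..4}. (frame_bracket \<alpha> \<beta> \<gamma> i j k - frame_bracket \<alpha> \<beta> \<gamma> j i k) *\<^sub>R Y k))"

definition diagonal :: "('g \<Rightarrow> 'g \<Rightarrow> real) \<Rightarrow> (nat \<Rightarrow> 'g) \<Rightarrow> bool" where
  "diagonal h Y \<longleftrightarrow> (\<forall>i\<in>{1..4}. \<forall>j\<in>{1..4}. i \<noteq> j \<longrightarrow> h (Y i) (Y j) = 0)"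

lemma atLeastAtMost_1_4: "{1..4::nat} = {1, 2, 3, 4}"
  by auto

lemma sum_1_4: "(\<Sum>i\<in>{1..4::nat}. f i) = f 1 + f 2 + f 3 + f 4"
  for f :: "nat \<Rightarrow> 'a::ab_group_add"
  unfolding atLeastAtMost_1_4 by (simp add: add.assoc)

text \<open>For \<open>\<beta> = \<gamma> = 0\<close> the hypothesis of the fourth claim says that
  the (2,3) entry vanishes. The relation in the last claim says that bracketing with
  \<open>Y 1\<close> is self-adjoint on the span of \<open>Y 2\<close> and \<open>Y 3\<close>; the
  (2,2) and (3,3) entries are then those of the Heisenberg algebra spanned by \<open>Y 2\<close>,
  \<open>Y 3\<close>, \<open>Y 4\<close>.\<close>

lemma ricci_adapted_frame:
  fixes br :: "'g::euclidean_space \<Rightarrow> 'g \<Rightarrow> 'g"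
  assumes br: "lie_bracket br" and h: "inner_product h" and Y: "adapted_frame br Y \<alpha> \<beta> \<gamma>"
    and orth: "\<And>i j. i \<in> {1..4} \<Longrightarrow> j \<in> {1..4} \<Longrightarrow> h (Y i) (Y j) = (if i = j then l i else 0)"
    and l: "\<And>i. i \<in> {1..4} \<Longrightarrow> l i > 0"
  shows "ricci br h (Y 1) (Y 2) = \<beta> * l 4 / (2 * l 3)" (is ?ric12)
    and "ricci br h (Y 1) (Y 3) = \<gamma> * l 4 / (2 * l 2)" (is ?ric13)
    and "ricci br h (Y 2) (Y 3) =
      - (2 * \<alpha> * l 2 + 2 * \<alpha> * (\<alpha>\<^sup>2 - 1) * l 3 - \<beta> * \<gamma> * l 4) / (2 * l 1)" (is ?ric23)
    and "\<beta> = 0 \<Longrightarrow> \<gamma> = 0 \<Longrightarrow> \<alpha> * (l 2 - (1 - \<alpha>\<^sup>2) * l 3) = 0 \<Longrightarrow> diagonal (ricci br h) Y"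
    and "\<beta> = 0 \<Longrightarrow> \<gamma> = 0 \<Longrightarrow> l 2 = (1 - \<alpha>\<^sup>2) * l 3 \<Longrightarrow>
      ricci br h (Y 2) (Y 2) = (1 - \<alpha>\<^sup>2) * ricci br h (Y 3) (Y 3)"
proof -
  define c where "c i j k = frame_bracket \<alpha> \<beta> \<gamma> i j k - frame_bracket \<alpha> \<beta> \<gamma> j i k" for i j k
  define \<Gamma> where "\<Gamma> i j k = (c i j k * l k - c j k i * l i + c k i j * l j) / (2 * l k)" for i j k
  have ric: "ricci br h (Y p) (Y q) = (\<Sum>i\<in>{1..4}. \<Sum>m\<in>{1..4}.
      \<Gamma> p q m * \<Gamma> i m i - \<Gamma> i q m * \<Gamma> p m i - c i p m * \<Gamma> m q i)"
    if "p \<in> {1..4}" "q \<in> {1..4}" for p q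
    by (rule ricci_orthogonal_frame[OF br h _ _ orth l _ \<Gamma>_def])
      (use Y that in \<open>auto simp: adapted_frame_def c_def\<close>)
  have pos: "l 1 > 0" "l 2 > 0" "l 3 > 0" "l 4 > 0" using l by auto
  then have l0: "l 1 \<noteq> 0" "l 2 \<noteq> 0" "l 3 \<noteq> 0" "l 4 \<noteq> 0" by auto
  note simps = ric[unfolded sum_1_4] \<Gamma>_def c_def frame_bracket_def
  show ?ric12 ?ric13 ?ric23
    using l0 by (simp_all add: simps del: One_nat_def)
      (simp_all add: field_simps power2_eq_square del: One_nat_def)
  \<comment> \<open>The transposed entries come from the same frame formula, since
    \<open>diagonal\<close> ranges over ordered pairs.\<close>
  have ric21: "ricci br h (Y 2) (Y 1) = \<beta> * l 4 / (2 * l 3)"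
    and ric31: "ricci br h (Y 3) (Y 1) = \<gamma> * l 4 / (2 * l 2)"
    and ric32: "ricci br h (Y 3) (Y 2) =
      - (2 * \<alpha> * l 2 + 2 * \<alpha> * (\<alpha>\<^sup>2 - 1) * l 3 - \<beta> * \<gamma> * l 4) / (2 * l 1)"
    using l0 by (simp_all add: simps del: One_nat_def)
      (simp_all add: field_simps power2_eq_square del: One_nat_def)
  show "diagonal (ricci br h) Y" if "\<beta> = 0" "\<gamma> = 0" "\<alpha> * (l 2 - (1 - \<alpha>\<^sup>2) * l 3) = 0"
  proof -
    have "ricci br h (Y p) (Y q) = 0"
      if "(p, q) \<in> {(1,4), (4,1), (2,4), (4,2), (3,4), (4,3)}" for p q
      using that \<open>\<beta> = 0\<close> \<open>\<gamma> = 0\<close> l0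
      by (elim insertE emptyE) (simp_all add: simps del: One_nat_def,
        simp_all add: field_simps del: One_nat_def)
    moreover have "2 * \<alpha> * l 2 + 2 * \<alpha> * (\<alpha>\<^sup>2 - 1) * l 3 = 0"
      using that(3) by (simp add: algebra_simps)
    ultimately show ?thesis
      using that(1,2) \<open>?ric12\<close> \<open>?ric13\<close> \<open>?ric23\<close> ric21 ric31 ric32
      unfolding diagonal_def atLeastAtMost_1_4 by (simp del: One_nat_def)
  qed
  show "ricci br h (Y 2) (Y 2) = (1 - \<alpha>\<^sup>2) * ricci br h (Y 3) (Y 3)"
    if "\<beta> = 0" "\<gamma> = 0" "l 2 = (1 - \<alpha>\<^sup>2) * l 3"
  proof -
    \<comment> \<open>Writing both \<open>l 2\<close> and \<open>\<alpha>\<^sup>2\<close> in terms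
      of \<open>s\<close>, which is nonzero because \<open>l 2\<close> is, lets the terms due to
      \<open>Y 1\<close> cancel.\<close>
    define s where "s = 1 - \<alpha>\<^sup>2"
    have s: "\<alpha>\<^sup>2 = 1 - s" by (simp add: s_def)
    have "s \<noteq> 0" using that(3) l0 by (auto simp: s_def)
    have l2: "l 2 = s * l 3" using that(3) by (simp add: s_def)
    have "ricci br h (Y 2) (Y 2) = - l 4 / (2 * l 3)"
      using l0 that(1,2) \<open>s \<noteq> 0\<close>
      by (simp add: simps l2 s del: One_nat_def)
    moreover have "ricci br h (Y 3) (Y 3) = - l 4 / (2 * l 2)"
      using l0 that(1,2) \<open>s \<noteq> 0\<close>
      by (simp add: simps l2 s del: One_nat_def)
    ultimately show ?thesis using l0 \<open>s \<noteq> 0\<close> by (simp add: l2 s_def[symmetric] )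
  qed
qed

section \<open>The change of basis from the \<open>X i\<close> to the \<open>Y i\<close>\<close>

lemma span_unitriangular_4:
  fixes X Y :: "nat \<Rightarrow> 'g::real_vector" and a :: "nat \<Rightarrow> real"
  assumes "span (X ` {1..4}) = UNIV"
    and Y: "Y 1 = X 1 + a 4 *\<^sub>R X 2 + a 5 *\<^sub>R X 3 + a 6 *\<^sub>R X 4"
      "Y 2 = X 2 + a 2 *\<^sub>R X 3 + a 3 *\<^sub>R X 4" "Y 3 = X 3 + a 1 *\<^sub>R X 4" "Y 4 = X 4"
  shows "span (Y ` {1..4}) = UNIV"
proof -
  let ?S = "span (Y ` {1..4})"
  have in_S: "Y 1 \<in> ?S" "Y 2 \<in> ?S" "Y 3 \<in> ?S" "Y 4 \<in> ?S"
    by (auto intro!: span_base)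
  have X4: "X 4 \<in> ?S" using in_S Y by simp
  have "Y 3 - a 1 *\<^sub>R X 4 \<in> ?S" by (intro span_diff span_scale in_S X4)
  then have X3: "X 3 \<in> ?S" by (simp add: Y)
  have "Y 2 - a 2 *\<^sub>R X 3 - a 3 *\<^sub>R X 4 \<in> ?S" by (intro span_diff span_scale in_S X3 X4)
  then have X2: "X 2 \<in> ?S" by (simp add: Y)
  have "Y 1 - a 4 *\<^sub>R X 2 - a 5 *\<^sub>R X 3 - a 6 *\<^sub>R X 4 \<in> ?S"
    by (intro span_diff span_scale in_S X2 X3 X4)
  then have X1: "X 1 \<in> ?S" by (simp add: Y del: One_nat_def)
  have "X ` {1..4} \<subseteq> ?S" using X1 X2 X3 X4 unfolding atLeastAtMost_1_4 by simp
  then have "span (X ` {1..4}) \<subseteq> ?S" by (simp add: span_minimal)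
  then show ?thesis using assms(1) by auto
qed

lemma lie_bracket_skew:
  assumes "lie_bracket br"
  shows "br x y = - br y x"
proof -
  have bb: "bilinear br" and alt: "\<And>x. br x x = 0" using assms by (auto simp: lie_bracket_def)
  show ?thesis
    using alt[of "x + y"] alt[of x] alt[of y]
    by (simp add: bilinear_ladd[OF bb] bilinear_radd[OF bb] eq_neg_iff_add_eq_0 add.commute)
qed

lemma adapted_frame_Y:
  fixes br :: "'g::euclidean_space \<Rightarrow> 'g \<Rightarrow> 'g" and X Y :: "nat \<Rightarrow> 'g"
    and a :: "nat \<Rightarrow> real"
  assumes br: "lie_bracket br" and span: "span (X ` {1..4}) = UNIV"
    and X: "br (X 1) (X 4) = 0" "br (X 2) (X 4) = 0" "br (X 3) (X 4) = 0"
      "br (X 2) (X 3) = X 4" "br (X 3) (X 1) = X 2" "br (X 1) (X 2) = - X 3"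
    and Y: "Y 1 = X 1 + a 4 *\<^sub>R X 2 + a 5 *\<^sub>R X 3 + a 6 *\<^sub>R X 4"
      "Y 2 = X 2 + a 2 *\<^sub>R X 3 + a 3 *\<^sub>R X 4" "Y 3 = X 3 + a 1 *\<^sub>R X 4" "Y 4 = X 4"
  shows "adapted_frame br Y (a 2) (a 1 * a 2 - a 3 - a 4)
    (a 1 - a 1 * (a 2)\<^sup>2 + a 2 * a 3 + a 2 * a 4 - a 5)"
proof -
  have bb: "bilinear br" and alt: "\<And>x. br x x = 0" using br by (auto simp: lie_bracket_def)
  note skew = lie_bracket_skew[OF br]
  have X': "br (X 4) (X 1) = 0" "br (X 4) (X 2) = 0" "br (X 4) (X 3) = 0"
    "br (X 3) (X 2) = - X 4" "br (X 1) (X 3) = - X 2" "br (X 2) (X 1) = X 3"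
    using skew[of "X 4" "X 1"] skew[of "X 4" "X 2"] skew[of "X 4" "X 3"]
      skew[of "X 3" "X 2"] skew[of "X 1" "X 3"] skew[of "X 2" "X 1"] X by simp_all
  have "br (Y i) (Y j) = (\<Sum>k\<in>{1..4}.
      (frame_bracket (a 2) (a 1 * a 2 - a 3 - a 4)
        (a 1 - a 1 * (a 2)\<^sup>2 + a 2 * a 3 + a 2 * a 4 - a 5) i j k -
       frame_bracket (a 2) (a 1 * a 2 - a 3 - a 4)
        (a 1 - a 1 * (a 2)\<^sup>2 + a 2 * a 3 + a 2 * a 4 - a 5) j i k) *\<^sub>R Y k)"
    if "i \<in> {1, 2, 3, 4}" "j \<in> {1, 2, 3, 4}" for i j
    unfolding sum_1_4 using that
    by (elim insertE emptyE) (simp_all add: frame_bracket_def Y alt X X'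
        bilinear_ladd[OF bb] bilinear_radd[OF bb] bilinear_lmul[OF bb] bilinear_rmul[OF bb]
        bilinear_rneg[OF bb] bilinear_lneg[OF bb] del: One_nat_def,
        simp_all add: algebra_simps power2_eq_square del: One_nat_def)
  then show ?thesis
    unfolding adapted_frame_def using span_unitriangular_4[OF span Y]
    unfolding atLeastAtMost_1_4 by blast
qed

section \<open>Sufficiency: the projection adapted to the frame\<close>

lemma ricci_flow_preserves_diagonal:
  fixes br :: "'g::euclidean_space \<Rightarrow> 'g \<Rightarrow> 'g"
  assumes br: "lie_bracket br" and Y: "adapted_frame br Y \<alpha> 0 0"
    and flow: "ricci_flow_on br {0..T} g" and T: "0 \<le> T"
    and orth: "\<And>i j. i \<in> {1..4} \<Longrightarrow> j \<in> {1..4} \<Longrightarrow> g 0 (Y i) (Y j) = (if i = j then l i else 0)"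
    and l: "\<And>i. i \<in> {1..4} \<Longrightarrow> l i > 0"
    and cond: "\<alpha> = 0 \<or> l 2 = (1 - \<alpha>\<^sup>2) * l 3"
  shows "diagonal (g T) Y"
proof -
  have span: "span (Y ` {1..4}) = UNIV" using Y by (simp add: adapted_frame_def)
  have ip: "inner_product (g t)" if "t \<in> {0..T}" for t
    using flow that by (auto simp: ricci_flow_on_def)
  have ip0: "inner_product (g 0)" using ip T by simp
  have bil: "bilinear h" if "inner_product h" for h :: "'g \<Rightarrow> 'g \<Rightarrow> real"
    using that by (simp add: inner_product_def)
  note b0 = bil[OF ip0]
  have Y0: "Y i \<noteq> 0" if "i \<in> {1..4}" for i
    using orth[OF that that] l[OF that] bilinear_lzero[OF b0, of "Y i"] by auto
  \<comment> \<open>The coordinate functionals dual to \<open>Y\<close>, written through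
    \<open>g 0\<close> because the frame is orthogonal for it. They do not vary with time, so
    neither does \<open>P\<close>.\<close>
  define \<xi> where "\<xi> i x = g 0 x (Y i) / l i" for i x
  have \<xi>Y: "\<xi> i (Y j) = (if i = j then 1 else 0)" if "i \<in> {1..4}" "j \<in> {1..4}" for i j
    using orth[OF that(2,1)] l[OF that(1)] by (auto simp: \<xi>_def)
  have \<xi>_add: "\<xi> i (x + y) = \<xi> i x + \<xi> i y" and \<xi>_scale: "\<xi> i (r *\<^sub>R x) = r * \<xi> i x" for i x y r
    by (simp_all add: \<xi>_def bilinear_ladd[OF b0] bilinear_lmul[OF b0] add_divide_distrib)
  have \<xi>_sum: "x = (\<Sum>i\<in>{1..4}. \<xi> i x *\<^sub>R Y i)" for x
    unfolding \<xi>_def by (rule orthogonal_frame_expansion[OF ip0 _ span orth l]) auto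
  define s where "s = (if \<alpha> = 0 then 1 else 1 - \<alpha>\<^sup>2)"
  define k :: nat where "k = (if \<alpha> = 0 then 2 else 3)"
  \<comment> \<open>If \<open>\<alpha>\<close> is nonzero, \<open>l 2 = s * l 3\<close> with both
    lengths positive. This sign is what makes \<open>P\<close> preserve positive
    definiteness.\<close>
  have "s > 0"
    using cond l[of 2] l[of 3] by (auto simp: s_def zero_less_mult_iff)
  \<comment> \<open>These encode that \<open>P\<close> replaces the entry (2,2) by \<open>s\<close>
    times the entry at \<open>k\<close> and keeps the other diagonal entries.\<close>
  define r where "r i = (if i = 2 then s else 1)" for i :: nat
  define \<sigma> where "\<sigma> i = (if i = 2 then k else i)" for i
  have r: "r i > 0" for i using \<open>s > 0\<close> by (simp add: r_def)
  have \<sigma>: "\<sigma> i \<in> {1..4}" if "i \<in> {1..4}" for i using that by (auto simp: \<sigma>_def k_def)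
  have k: "k \<in> {1..4}" "\<sigma> k = k" "r k = 1" by (auto simp: k_def \<sigma>_def r_def s_def)
  \<comment> \<open>The projection onto the diagonal forms with \<open>F (Y 2) (Y 2) = s * F (Y k) (Y k)\<close>, a vacuous
    condition if \<open>\<alpha> = 0\<close>.\<close>
  define P where
    "P F x y = (\<Sum>i\<in>{1..4}. (r i * \<xi> i x * \<xi> i y) * F (Y (\<sigma> i)) (Y (\<sigma> i)))"
    for F :: "'g \<Rightarrow> 'g \<Rightarrow> real" and x y
  have PY: "P F (Y i) (Y j) = (if i = j then r i * F (Y (\<sigma> i)) (Y (\<sigma> i)) else 0)"
    if "i \<in> {1..4}" "j \<in> {1..4}" for F i j
  proof -
    have "P F (Y i) (Y j) =
        (\<Sum>m\<in>{1..4}. if m = i then (if i = j then r i * F (Y (\<sigma> i)) (Y (\<sigma> i)) else 0) else 0)"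
      unfolding P_def by (rule sum.cong) (use that in \<open>auto simp: \<xi>Y\<close>)
    then show ?thesis using that by (simp add: sum.delta)
  qed
  have bilP: "bilinear (P F)" for F
    unfolding bilinear_def P_def
    by (intro conjI allI linearI)
      (simp_all add: \<xi>_add \<xi>_scale sum.distrib[symmetric] sum_distrib_left algebra_simps)
  have P_fix: "P F = F"
    if "bilinear F" "diagonal F Y" "F (Y 2) (Y 2) = s * F (Y k) (Y k)" for F
  proof -
    have *: "P F (Y i) (Y j) = F (Y i) (Y j)" if "i \<in> {1..4}" "j \<in> {1..4}" for i j
      using that \<open>diagonal F Y\<close> \<open>F (Y 2) (Y 2) = s * F (Y k) (Y k)\<close>
      by (auto simp: PY diagonal_def r_def \<sigma>_def)
    have "P F x y = F x y" for x y
      by (rule bilinear_eq[OF bilP that(1), of UNIV "Y ` {1..4}" UNIV "Y ` {1..4}"])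
        (use span * in auto)
    then show ?thesis by blast
  qed
  have P_diag: "diagonal (P F) Y" for F
    using PY[of _ _ F] by (simp add: diagonal_def)
  have P_k: "P F (Y 2) (Y 2) = s * P F (Y k) (Y k)" for F
    using PY[of 2 2 F] PY[OF k(1) k(1), of F] k by (simp add: r_def \<sigma>_def)
  have "P (g T) = g T"
  proof (rule ricci_flow_preserves_projection[OF br flow T P_def])
    fix h :: "'g \<Rightarrow> 'g \<Rightarrow> real" assume h: "inner_product h"
    have pos: "h (Y i) (Y i) > 0" if "i \<in> {1..4}" for i
      using h Y0[OF that] by (simp add: inner_product_def)
    show "P (P h) = P h" by (intro P_fix bilP P_diag P_k)
    show "inner_product (P h)"
      unfolding inner_product_def
    proof (intro conjI allI impI bilP)
      show "P h x y = P h y x" for x y by (simp add: P_def mult_ac)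
      fix x :: 'g assume "x \<noteq> 0"
      \<comment> \<open>A nonzero vector has a nonzero coordinate. Its summand in
        \<open>P h x x\<close> is positive and the others are nonnegative.\<close>
      then obtain m where m: "m \<in> {1..4}" "\<xi> m x \<noteq> 0"
        using \<xi>_sum[of x] by (metis (no_types, lifting) scale_eq_0_iff sum.neutral)
      show "P h x x > 0" unfolding P_def
      proof (rule sum_pos2[OF _ m(1)])
        show "0 < r m * \<xi> m x * \<xi> m x * h (Y (\<sigma> m)) (Y (\<sigma> m))"
        proof -
          have "0 < \<xi> m x * \<xi> m x" using m(2) by (metis mult_eq_0_iff not_real_square_gt_zero)
          then have "0 < r m * (\<xi> m x * \<xi> m x) * h (Y (\<sigma> m)) (Y (\<sigma> m))"
            by (rule mult_pos_pos[OF mult_pos_pos[OF r] pos[OF \<sigma>[OF m(1)]]])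
          then show ?thesis by (simp only: mult.assoc)
        qed
        show "0 \<le> r i * \<xi> i x * \<xi> i x * h (Y (\<sigma> i)) (Y (\<sigma> i))" if "i \<in> {1..4}" for i
        proof -
          have "0 \<le> r i * (\<xi> i x * \<xi> i x) * h (Y (\<sigma> i)) (Y (\<sigma> i))"
            by (rule mult_nonneg_nonneg[OF mult_nonneg_nonneg[OF less_imp_le[OF r] zero_le_square]
                  less_imp_le[OF pos[OF \<sigma>[OF that]]]])
          then show ?thesis by (simp only: mult.assoc)
        qed
      qed simp
    qed
    assume "P h = h"
    \<comment> \<open>Everything in the image of \<open>P\<close> satisfies the two constraints, so
      a fixed point does.\<close>
    then have dh: "diagonal h Y" and kh: "h (Y 2) (Y 2) = s * h (Y k) (Y k)"
      using P_diag[of h] P_k[of h] by simp_all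
    have orth_h: "h (Y i) (Y j) = (if i = j then h (Y i) (Y i) else 0)"
      if "i \<in> {1..4}" "j \<in> {1..4}" for i j
      using dh that by (auto simp: diagonal_def)
    note ric = ricci_adapted_frame(4,5)[where l = "\<lambda>i. h (Y i) (Y i)", OF br h Y]
    have kh': "h (Y 2) (Y 2) = (1 - \<alpha>\<^sup>2) * h (Y 3) (Y 3)" if "\<alpha> \<noteq> 0"
    proof -
      have sk: "s = 1 - \<alpha>\<^sup>2" "k = 3" using that by (simp_all add: s_def k_def)
      show ?thesis by (rule kh[unfolded sk])
    qed
    then have eq: "\<alpha> * (h (Y 2) (Y 2) - (1 - \<alpha>\<^sup>2) * h (Y 3) (Y 3)) = 0"
      by (cases "\<alpha> = 0") simp_all
    show "P (ricci br h) = ricci br h"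
    proof (rule P_fix[OF bilinear_ricci[OF br h]])
      show "diagonal (ricci br h) Y"
        by (rule ric(1)[OF _ _ refl refl eq]; rule orth_h pos; assumption)
      show "ricci br h (Y 2) (Y 2) = s * ricci br h (Y k) (Y k)"
      proof (cases "\<alpha> = 0")
        case False
        have "ricci br h (Y 2) (Y 2) = (1 - \<alpha>\<^sup>2) * ricci br h (Y 3) (Y 3)"
          by (rule ric(2)[OF _ _ refl refl kh'[OF False]]; rule orth_h pos; assumption)
        then show ?thesis by (simp only: s_def k_def if_not_P[OF False])
      qed (simp add: s_def k_def)
    qed
  next
    show "P (g 0) = g 0"
    proof (rule P_fix[OF b0])
      show "diagonal (g 0) Y" using orth by (simp add: diagonal_def)
      show "g 0 (Y 2) (Y 2) = s * g 0 (Y k) (Y k)"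
        using orth[of 2 2] orth[OF k(1) k(1)] cond by (auto simp: s_def k_def)
    qed
  qed
  then show ?thesis using P_diag[of "g T"] by simp
qed

section \<open>Necessity: derivatives of the off-diagonal entries at time 0, and the
  equivalence\<close>

lemma has_real_derivative_zero_right:
  fixes f :: "real \<Rightarrow> real"
  assumes f: "(f has_real_derivative d) (at 0)" and e: "e > 0"
    and zero: "\<And>t. 0 \<le> t \<Longrightarrow> t < e \<Longrightarrow> f t = 0"
  shows "d = 0"
proof -
  \<comment> \<open>The vanishing is known only for nonnegative times, so the two-sided derivative
    is restricted to the half-line, where derivatives are still unique.\<close>
  have "(f has_real_derivative d) (at 0 within {0..})"
    using f by (rule has_field_derivative_at_within)
  moreover have "(f has_real_derivative 0) (at 0 within {0..})"
  proof (rule has_field_derivative_transform_within[OF _ e])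
    show "((\<lambda>_. 0::real) has_real_derivative 0) (at 0 within {0..})" by simp
  qed (use zero e in \<open>auto simp: dist_real_def\<close>)
  ultimately show ?thesis
    using has_field_derivative_unique[of f d 0 "{0..}" 0]
    by (simp add: at_within_Ici_at_right trivial_limit_at_right_real)
qed

theorem proposition6:
  fixes br :: "'g::euclidean_space \<Rightarrow> 'g \<Rightarrow> 'g"
    and X Y :: "nat \<Rightarrow> 'g"
    and a l :: "nat \<Rightarrow> real"
    and \<alpha> \<beta> \<gamma> :: real
    and g0 :: "'g \<Rightarrow> 'g \<Rightarrow> real"
    and I :: "real set"
    and g :: "real \<Rightarrow> 'g \<Rightarrow> 'g \<Rightarrow> real"
  assumes "lie_bracket br"
    and "inj_on X {1..4}" and "independent (X ` {1..4})" and "span (X ` {1..4}) = UNIV"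
    and "br (X 1) (X 4) = 0" and "br (X 2) (X 4) = 0" and "br (X 3) (X 4) = 0"
    and "br (X 2) (X 3) = X 4" and "br (X 3) (X 1) = X 2" and "br (X 1) (X 2) = - X 3"
    and "Y 1 = X 1 + a 4 *\<^sub>R X 2 + a 5 *\<^sub>R X 3 + a 6 *\<^sub>R X 4"
    and "Y 2 = X 2 + a 2 *\<^sub>R X 3 + a 3 *\<^sub>R X 4"
    and "Y 3 = X 3 + a 1 *\<^sub>R X 4"
    and "Y 4 = X 4"
    and "inner_product g0"
    and "\<forall>i\<in>{1..4}. l i > 0"
    and "\<forall>i\<in>{1..4}. \<forall>j\<in>{1..4}. g0 (Y i) (Y j) = (if i = j then l i else 0)"
    and "\<alpha> = a 2"
    and "\<beta> = a 1 * a 2 - a 3 - a 4"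
    and "\<gamma> = a 1 - a 1 * (a 2)\<^sup>2 + a 2 * a 3 + a 2 * a 4 - a 5"
    and "maximal_ricci_flow br g0 I g"
  shows "(\<forall>t\<in>I. t \<ge> 0 \<longrightarrow> (\<forall>i\<in>{1..4}. \<forall>j\<in>{1..4}. i \<noteq> j \<longrightarrow> g t (Y i) (Y j) = 0)) \<longleftrightarrow>
    (\<alpha> = 0 \<and> \<beta> = 0 \<and> \<gamma> = 0) \<or>
    (\<beta> = 0 \<and> \<gamma> = 0 \<and> l 2 = (1 - \<alpha>\<^sup>2) * l 3)"
    (is "?diagonal \<longleftrightarrow> ?conditions")
proof -
  have Y: "adapted_frame br Y \<alpha> \<beta> \<gamma>"
    unfolding assms(18-20) by (rule adapted_frame_Y[OF assms(1,4-14)])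
  have I: "open I" "is_interval I" "0 \<in> I" and flow: "ricci_flow_on br I g" and g0: "g 0 = g0"
    using assms(21) by (auto simp: maximal_ricci_flow_def)
  have orth: "g 0 (Y i) (Y j) = (if i = j then l i else 0)" if "i \<in> {1..4}" "j \<in> {1..4}" for i j
    using assms(17) that g0 by blast
  have l: "l i > 0" if "i \<in> {1..4}" for i using assms(16) that by blast
  have ip: "inner_product (g 0)" using assms(15) g0 by simp
  have pos: "l 1 > 0" "l 2 > 0" "l 3 > 0" "l 4 > 0" using l by auto
  show ?thesis
  proof
    assume diag: ?diagonal
    \<comment> \<open>Openness of \<open>I\<close> provides a right neighbourhood of 0 on which the
      flow exists and is diagonal.\<close>
    obtain e where e: "e > 0" "ball 0 e \<subseteq> I" using I openE by blast
    have ric0: "ricci br (g 0) (Y i) (Y j) = 0" if "i \<in> {1..4}" "j \<in> {1..4}" "i \<noteq> j" for i j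
    proof -
      have "((\<lambda>s. g s (Y i) (Y j)) has_real_derivative - 2 * ricci br (g 0) (Y i) (Y j)) (at 0)"
        using flow I(3) by (auto simp: ricci_flow_on_def)
      then have "- 2 * ricci br (g 0) (Y i) (Y j) = 0"
      proof (rule has_real_derivative_zero_right[OF _ e(1)])
        fix t assume t: "0 \<le> t" "t < e"
        then have "t \<in> I" using e(2) by auto
        then show "g t (Y i) (Y j) = 0" using diag that t(1) by blast
      qed
      then show ?thesis by simp
    qed
    note ric = ricci_adapted_frame(1-3)[OF assms(1) ip Y orth l]
    have \<beta>: "\<beta> = 0" using ric(1) ric0[of 1 2] pos by simp
    have \<gamma>: "\<gamma> = 0" using ric(2) ric0[of 1 3] pos by simp
    have "\<alpha> * (l 2 - (1 - \<alpha>\<^sup>2) * l 3) = 0"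
      \<comment> \<open>\<open>\<beta> = 0\<close> removes the term
        \<open>\<beta> * \<gamma> * l 4\<close> from the (2,3) entry; what remains is a product
        whose two factors yield the two alternatives.\<close>
      using ric(3) ric0[of 2 3] pos \<beta> by (simp add: algebra_simps)
    then show ?conditions using \<beta> \<gamma> by auto
  next
    assume cond: ?conditions
    have Y': "adapted_frame br Y \<alpha> 0 0" using Y cond by auto
    have "diagonal (g t) Y" if t: "t \<in> I" "0 \<le> t" for t
    proof (rule ricci_flow_preserves_diagonal[where g = g, OF assms(1) Y' _ t(2) orth l])
      have "{0..t} \<subseteq> I" using I t mem_is_interval_1_I[OF I(2) I(3) t(1)] by auto
      then show "ricci_flow_on br {0..t} g" using flow by (auto simp: ricci_flow_on_def)
      show "\<alpha> = 0 \<or> l 2 = (1 - \<alpha>\<^sup>2) * l 3" using cond by auto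
    qed
    then show ?diagonal unfolding diagonal_def by blast
  qed
qed

end
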